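(* Let $M_1,M_2$ and $M_3=M_3(x)$, $M_4=M_4(x)$, $\beta=\beta(x)$, $\gamma=\gamma(x)$ be as in the context, and let $$\sigma_{\min}=\min\left\{\sqrt{|\mu|}\ :\ \mu\text{ is an eigenvalue of }M_1^*M_2M_2^*M_1\right\}.$$ If $L^+_{\mathrm{conj}}$ is sufficiently large so that for any $x\ge L^+_{\mathrm{conj}}$ we have $\|(\check{\mathcal V}^{\mathrm{s}}_{1;4})^{-1}\tilde{\mathcal W}^{+,\mathrm{s}}_{1;4}(x)\|<1$ and $$\sigma_{\min}>\left(\|M_1\|+\|M_3\|\right)\left[\|\beta\|\|\gamma\|^{-1}+\|M_4\|\right]+\|M_2\|\|M_3\|,$$ then a conjugate point cannot occur for $x\ge L^+_{\mathrm{conj}}$; that is, $\mathbb{E}^{\mathrm{u}}_-(x)\cap\ell_{\mathrm{sand}}=\{0\}$ for all $x\ge L^+_{\mathrm{conj}}$.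
   Context: Fix $\hat\mu,\hat\nu>0$ and $f(u)=\hat\nu u^2-u^3-\hat\mu u$. Let $\varphi:\mathbb{R}\to\mathbb{R}$ be a (nonzero) pulse: $0=-(1+\partial_x^2)^2\varphi+f(\varphi)$, $\lim_{|x|\to\infty}\varphi(x)=0$. Consider $Q'=B(x)Q$ with $$B(x)=\begin{pmatrix}0&0&0&1\\0&0&1&-2\\-1+f'(\varphi(x))&0&0&0\\0&1&0&0\end{pmatrix},\quad B_\infty=\lim_{|x|\to\infty}B(x);$$ there are $K_B,C_B>0$ with $\|B(x)-B_\infty\|\le K_Be^{-C_B|x|}$. $\mathbb{E}^{\mathrm{u}}_-(x)\subset\mathbb{R}^4$ (resp. $\mathbb{C}\mathbb{E}^{\mathrm{u}}_-(x)\subset\mathbb{C}^4$) is the set of values at $x$ of real (resp. complex) solutions tending to $0$ as $x\to-\infty$; $\mathbb{C}\mathbb{E}^{\mathrm{s}}_+(x)$ is the set of values at $x$ of complex solutions tending to $0$ as $x\to+\infty$. $\ell_{\mathrm{sand}}=\{(0,u_1,u_2,0)^T:u_1,u_2\in\mathbb{R}\}$. A conjugate point is an $x$ with $\mathbb{E}^{\mathrm{u}}_-(x)\cap\ell_{\mathrm{sand}}\ne\{0\}$. Let $\rho=\sqrt{1+\hat\mu}$, $\tan\theta=-\sqrt{\hat\mu}$, $\theta\in(\pi/2,\pi)$. The eigenvalues of $B_\infty$ are $\mu_1^{\mathrm{u}}=\sqrt\rho e^{i\theta/2}$, $\mu_2^{\mathrm{u}}=\sqrt\rho e^{-i\theta/2}$,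 $\mu_j^{\mathrm{s}}=-\mu_j^{\mathrm{u}}$, with eigenvectors $$\check V_1^{\mathrm{u}}=\big(\tfrac1\rho e^{-i\theta},1,c,\tfrac1{\sqrt\rho}e^{-i\theta/2}\big)^T,\quad \check V_1^{\mathrm{s}}=\big(\tfrac1\rho e^{-i\theta},1,-c,-\tfrac1{\sqrt\rho}e^{-i\theta/2}\big)^T,\quad c=\sqrt\rho e^{i\theta/2}+\tfrac2{\sqrt\rho}e^{-i\theta/2},$$ and $\check V_2^{\mathrm{s}/\mathrm{u}}=\overline{\check V_1^{\mathrm{s}/\mathrm{u}}}$. Put $\check{\mathcal V}^{\mathrm{s}/\mathrm{u}}=[\check V_1^{\mathrm{s}/\mathrm{u}}|\check V_2^{\mathrm{s}/\mathrm{u}}]\in\mathbb{C}^{4\times2}$. For a matrix $\mathcal{M}$ with four rows, $\mathcal{M}_{i;j}$ is the submatrix consisting of rows $i$ and $j$. Let $V_j^{+,\mathrm{s}/\mathrm{u}}(x)=e^{\mu_j^{\mathrm{s}/\mathrm{u}}x}(\check V_j^{\mathrm{s}/\mathrm{u}}+\tilde W_j^{+,\mathrm{s}/\mathrm{u}}(x))$, $j=1,2$, be complex solutions of $Q'=B(x)Q$ with $\tilde W_j^{+,\mathrm{s}/\mathrm{u}}(x)\to0$ as $x\to\infty$; these four form a basis of solutions. Put $\tilde{\mathcal W}^{+,\mathrm{s}/\mathrm{u}}=[\tilde W_1^{+,\mathrm{s}/\mathrm{u}}|\tilde W_2^{+,\mathrm{s}/\mathrm{u}}]$. Standing assumption ($\lambda=0$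 is a simple eigenvalue): $\mathbb{C}\mathbb{E}^{\mathrm{u}}_-(x)\cap\mathbb{C}\mathbb{E}^{\mathrm{s}}_+(x)=\mathrm{span}\{U_{\varphi'}(x)\}$, where $U_{\varphi'}=(\varphi',\varphi''',\varphi''''+2\varphi'',\varphi'')$. Let $U_1(x)$ be a solution with $\mathbb{C}\mathbb{E}^{\mathrm{u}}_-(x)=\mathrm{span}\{U_{\varphi'}(x),U_1(x)\}$. The vectors $\beta(x),\gamma(x)\in\mathbb{C}^2$ are defined by $$U_1(x)=(\check{\mathcal V}^{\mathrm{s}}+\tilde{\mathcal W}^{+,\mathrm{s}}(x))\beta(x)+(\check{\mathcal V}^{\mathrm{u}}+\tilde{\mathcal W}^{+,\mathrm{u}}(x))\gamma(x);$$ $\gamma(x)\neq0$ for all $x$. Set (with $^*$ the conjugate transpose) $$M_1=(\check{\mathcal V}^{\mathrm{s}}_{3;4})^*\check{\mathcal V}^{\mathrm{u}}_{1;2}+(\check{\mathcal V}^{\mathrm{u}}_{1;2})^*\check{\mathcal V}^{\mathrm{s}}_{3;4},\qquad M_2=(\check{\mathcal V}^{\mathrm{s}}_{1;4})^{-1}\check{\mathcal V}^{\mathrm{u}}_{1;4},$$ $$M_3=(\check{\mathcal V}^{\mathrm{s}}_{3;4})^*\tilde{\mathcal W}^{+,\mathrm{u}}_{1;2}-(\check{\mathcal V}^{\mathrm{s}}_{1;2})^*\tilde{\mathcal W}^{+,\mathrm{u}}_{3;4}+(\tilde{\mathcal W}^{+,\mathrm{s}}_{3;4})^*(\check{\mathcal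 V}^{\mathrm{u}}_{1;2}+\tilde{\mathcal W}^{+,\mathrm{u}}_{1;2})-(\tilde{\mathcal W}^{+,\mathrm{s}}_{1;2})^*(\check{\mathcal V}^{\mathrm{u}}_{3;4}+\tilde{\mathcal W}^{+,\mathrm{u}}_{3;4}),$$ $$M_4=M_2(\check{\mathcal V}^{\mathrm{u}}_{1;4})^{-1}\tilde{\mathcal W}^{+,\mathrm{u}}_{1;4}+\Big(\sum_{k=1}^\infty(-1)^k\big((\check{\mathcal V}^{\mathrm{s}}_{1;4})^{-1}\tilde{\mathcal W}^{+,\mathrm{s}}_{1;4}\big)^k\Big)M_2\big(I_2+(\check{\mathcal V}^{\mathrm{u}}_{1;4})^{-1}\tilde{\mathcal W}^{+,\mathrm{u}}_{1;4}\big).$$ Norms: Euclidean norm on vectors, induced operator norm on matrices. *)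

theory Defs
  imports "HOL-Analysis.Analysis"
begin

lemma vector_4 [simp]:
  "(vector [a, b, c, d] :: 'a::zero^4) $ 1 = a"
  "(vector [a, b, c, d] :: 'a::zero^4) $ 2 = b"
  "(vector [a, b, c, d] :: 'a::zero^4) $ 3 = c"
  "(vector [a, b, c, d] :: 'a::zero^4) $ 4 = d"
  unfolding vector_def by simp_all


section \<open>Matrices\<close>

text \<open>The library norm on \<open>'a^'n^'m\<close> is the Frobenius norm, and its \<open>power\<close> is taken entrywise;
  hence the following two definitions.\<close>

definition mat_norm :: "complex^'n^'m \<Rightarrow> real" where
  "mat_norm A = onorm ((*v) A)"

primrec mat_power :: "complex^'n^'n \<Rightarrow> nat \<Rightarrow> complex^'n^'n" where
  "mat_power A 0 = mat 1"
| "mat_power A (Suc k) = A ** mat_power A k"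

definition ctranspose :: "complex^'n^'m \<Rightarrow> complex^'m^'n" where
  "ctranspose A = (\<chi> i j. cnj (A $ j $ i))"

definition mat_eigenvalue :: "complex^'n^'n \<Rightarrow> complex \<Rightarrow> bool" where
  "mat_eigenvalue A z \<longleftrightarrow> (\<exists>v. v \<noteq> 0 \<and> A *v v = z *s v)"

definition vec_cnj :: "complex^'n \<Rightarrow> complex^'n" where
  "vec_cnj v = (\<chi> i. cnj (v $ i))"

definition vec_of_real :: "real^'n \<Rightarrow> complex^'n" where
  "vec_of_real v = (\<chi> i. complex_of_real (v $ i))"

definition col_mat :: "('n \<Rightarrow> complex^'m) \<Rightarrow> complex^'n^'m" where
  "col_mat v = (\<chi> i j. v j $ i)"

definition two_rows :: "'m \<Rightarrow> 'm \<Rightarrow> complex^'n^'m \<Rightarrow> complex^'n^2" where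
  "two_rows i j A = vector [row i A, row j A]"


section \<open>The pulse and the linearised system\<close>

definition nonlin :: "real \<Rightarrow> real \<Rightarrow> real \<Rightarrow> real" where
  "nonlin muh nuh u = nuh * u\<^sup>2 - u ^ 3 - muh * u"

definition one_plus_dxx :: "(real \<Rightarrow> real) \<Rightarrow> real \<Rightarrow> real" where
  "one_plus_dxx u = (\<lambda>x. u x + (deriv ^^ 2) u x)"

definition is_pulse :: "real \<Rightarrow> real \<Rightarrow> (real \<Rightarrow> real) \<Rightarrow> bool" where
  "is_pulse muh nuh \<phi> \<longleftrightarrow>
     (\<exists>x. \<phi> x \<noteq> 0) \<and>
     (\<forall>k<4. \<forall>x. (deriv ^^ k) \<phi> differentiable (at x)) \<and>
     (\<forall>x. 0 = - one_plus_dxx (one_plus_dxx \<phi>) x + nonlin muh nuh (\<phi> x)) \<and>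
     (\<phi> \<longlongrightarrow> 0) at_infinity"

definition Bmat :: "real \<Rightarrow> real \<Rightarrow> (real \<Rightarrow> real) \<Rightarrow> real \<Rightarrow> real^4^4" where
  "Bmat muh nuh \<phi> x = vector
     [vector [0, 0, 0, 1],
      vector [0, 0, 1, -2],
      vector [-1 + deriv (nonlin muh nuh) (\<phi> x), 0, 0, 0],
      vector [0, 1, 0, 0]]"

definition BmatC :: "real \<Rightarrow> real \<Rightarrow> (real \<Rightarrow> real) \<Rightarrow> real \<Rightarrow> complex^4^4" where
  "BmatC muh nuh \<phi> x = map_matrix complex_of_real (Bmat muh nuh \<phi> x)"

text \<open>Solutions are defined on the whole line; \<open>'a\<close> is \<open>real\<close> or \<open>complex\<close>.\<close>

definition lin_solution :: "(real \<Rightarrow> 'a::real_normed_field^'n^'n) \<Rightarrow> (real \<Rightarrow> 'a^'n) \<Rightarrow> bool" where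
  "lin_solution A Q \<longleftrightarrow> (\<forall>x. (Q has_vector_derivative (A x *v Q x)) (at x))"

definition Eu_minus :: "(real \<Rightarrow> 'a::real_normed_field^'n^'n) \<Rightarrow> real \<Rightarrow> ('a^'n) set" where
  "Eu_minus A x = {Q x | Q. lin_solution A Q \<and> (Q \<longlongrightarrow> 0) at_bot}"

definition Es_plus :: "(real \<Rightarrow> 'a::real_normed_field^'n^'n) \<Rightarrow> real \<Rightarrow> ('a^'n) set" where
  "Es_plus A x = {Q x | Q. lin_solution A Q \<and> (Q \<longlongrightarrow> 0) at_top}"

definition ell_sand :: "(real^4) set" where
  "ell_sand = {vector [0, u1, u2, 0] | u1 u2. True}"

definition conjugate_point :: "real \<Rightarrow> real \<Rightarrow> (real \<Rightarrow> real) \<Rightarrow> real \<Rightarrow> bool" where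
  "conjugate_point muh nuh \<phi> x \<longleftrightarrow> Eu_minus (Bmat muh nuh \<phi>) x \<inter> ell_sand \<noteq> {0}"

definition U_phi' :: "(real \<Rightarrow> real) \<Rightarrow> real \<Rightarrow> real^4" where
  "U_phi' \<phi> x = vector
     [deriv \<phi> x,
      (deriv ^^ 3) \<phi> x,
      (deriv ^^ 4) \<phi> x + 2 * (deriv ^^ 2) \<phi> x,
      (deriv ^^ 2) \<phi> x]"


section \<open>Eigenvalues and eigenvectors of the asymptotic matrix\<close>

text \<open>The argument of type \<open>2\<close> is the index \<open>j\<close> with values 1 and 2.\<close>

definition mu_u :: "real \<Rightarrow> real \<Rightarrow> 2 \<Rightarrow> complex" where
  "mu_u \<rho> \<theta> j = (if j = 1 then complex_of_real (sqrt \<rho>) * exp (\<i> * complex_of_real (\<theta> / 2))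
                 else complex_of_real (sqrt \<rho>) * exp (- \<i> * complex_of_real (\<theta> / 2)))"

definition mu_s :: "real \<Rightarrow> real \<Rightarrow> 2 \<Rightarrow> complex" where
  "mu_s \<rho> \<theta> j = - mu_u \<rho> \<theta> j"

definition c_const :: "real \<Rightarrow> real \<Rightarrow> complex" where
  "c_const \<rho> \<theta> = complex_of_real (sqrt \<rho>) * exp (\<i> * complex_of_real (\<theta> / 2))
     + complex_of_real (2 / sqrt \<rho>) * exp (- \<i> * complex_of_real (\<theta> / 2))"

definition V1u :: "real \<Rightarrow> real \<Rightarrow> complex^4" where
  "V1u \<rho> \<theta> = vector
     [complex_of_real (1 / \<rho>) * exp (- \<i> * complex_of_real \<theta>),
      1,
      c_const \<rho> \<theta>,
      complex_of_real (1 / sqrt \<rho>) * exp (- \<i> * complex_of_real (\<theta> / 2))]"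

definition V1s :: "real \<Rightarrow> real \<Rightarrow> complex^4" where
  "V1s \<rho> \<theta> = vector
     [complex_of_real (1 / \<rho>) * exp (- \<i> * complex_of_real \<theta>),
      1,
      - c_const \<rho> \<theta>,
      - complex_of_real (1 / sqrt \<rho>) * exp (- \<i> * complex_of_real (\<theta> / 2))]"

definition Vu :: "real \<Rightarrow> real \<Rightarrow> 2 \<Rightarrow> complex^4" where
  "Vu \<rho> \<theta> j = (if j = 1 then V1u \<rho> \<theta> else vec_cnj (V1u \<rho> \<theta>))"

definition Vs :: "real \<Rightarrow> real \<Rightarrow> 2 \<Rightarrow> complex^4" where
  "Vs \<rho> \<theta> j = (if j = 1 then V1s \<rho> \<theta> else vec_cnj (V1s \<rho> \<theta>))"


section \<open>The matrices in the criterion\<close>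

text \<open>Arguments: \<open>S\<close>, \<open>U\<close> are the \<open>4 \<times> 2\<close> matrices of stable and unstable eigenvectors,
  \<open>WS\<close>, \<open>WU\<close> the corresponding matrices of remainders at a point.\<close>

definition M1 :: "complex^2^4 \<Rightarrow> complex^2^4 \<Rightarrow> complex^2^2" where
  "M1 S U = ctranspose (two_rows 3 4 S) ** two_rows 1 2 U
          + ctranspose (two_rows 1 2 U) ** two_rows 3 4 S"

definition M2 :: "complex^2^4 \<Rightarrow> complex^2^4 \<Rightarrow> complex^2^2" where
  "M2 S U = matrix_inv (two_rows 1 4 S) ** two_rows 1 4 U"

definition M3 ::
  "complex^2^4 \<Rightarrow> complex^2^4 \<Rightarrow> complex^2^4 \<Rightarrow> complex^2^4 \<Rightarrow> complex^2^2" where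
  "M3 S U WS WU =
     ctranspose (two_rows 3 4 S) ** two_rows 1 2 WU
     - ctranspose (two_rows 1 2 S) ** two_rows 3 4 WU
     + ctranspose (two_rows 3 4 WS) ** (two_rows 1 2 U + two_rows 1 2 WU)
     - ctranspose (two_rows 1 2 WS) ** (two_rows 3 4 U + two_rows 3 4 WU)"

definition M4 ::
  "complex^2^4 \<Rightarrow> complex^2^4 \<Rightarrow> complex^2^4 \<Rightarrow> complex^2^4 \<Rightarrow> complex^2^2" where
  "M4 S U WS WU =
     M2 S U ** matrix_inv (two_rows 1 4 U) ** two_rows 1 4 WU
     + (\<Sum>k. (-1) ^ Suc k *\<^sub>R
          mat_power (matrix_inv (two_rows 1 4 S) ** two_rows 1 4 WS) (Suc k))
       ** M2 S U ** (mat 1 + matrix_inv (two_rows 1 4 U) ** two_rows 1 4 WU)"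

definition sigma_min :: "complex^2^2 \<Rightarrow> complex^2^2 \<Rightarrow> real" where
  "sigma_min A B = Min {sqrt (cmod z) | z.
     mat_eigenvalue (ctranspose A ** B ** ctranspose B ** A) z}"

end

theory Submission
  imports Defs
begin

text \<open>
  The linearised system preserves the Hermitian form \<open>sform\<close>, so \<open>sform\<close> vanishes on pairs of
  solutions decaying at the same end. Write \<open>U_phi' = (S + WS) \<alpha>\<close> at a point. Vanishing at
  \<open>-\<infinity>\<close> gives \<open>sform U_phi' U1 = 0\<close>, vanishing at \<open>+\<infinity>\<close> removes the \<open>\<beta>\<close>-part
  of \<open>U1\<close>, and what remains is \<open>\<alpha>\<^sup>* (M1 + M3) \<gamma> = 0\<close>. If some \<open>a U_phi' + U1\<close> lies in the
  sandwich plane, then its rows 1 and 4 give \<open>a \<alpha> + \<beta> = - (M2 + M4) \<gamma>\<close>, the inverse of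
  \<open>S + WS\<close> on these rows being a Neumann series. Eliminating \<open>a \<alpha>\<close> bounds
  \<open>|\<gamma>\<^sup>* M2\<^sup>* M1 \<gamma>|\<close> by the right-hand side of the criterion times \<open>|\<gamma>|\<^sup>2\<close>.

  For a general matrix the smallest singular value does not bound the quadratic form from below.
  Here it does, because \<open>M2\<^sup>* M1\<close> is Hermitian and semidefinite: with \<open>r = \<rho>\<^bsup>-1/2\<^esup> e\<^bsup>-i\<theta>/2\<^esup>\<close> its
  diagonal entries are both \<open>8 Re r\<close> and its off-diagonal entry is no larger in modulus, thanks to
  \<open>Re r\<^sup>2 = - |r|\<^sup>4\<close>.
\<close>

section \<open>Complex matrices\<close>

text \<open>Conjugate-linear in the first argument, so that \<open>ctranspose\<close> is the
  adjoint. It is complex-valued: orthogonality has to survive multiplication by complex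
  scalars.\<close>

definition hinner :: "complex^'n \<Rightarrow> complex^'n \<Rightarrow> complex" where
  "hinner u v = (\<Sum>i\<in>UNIV. cnj (u $ i) * v $ i)"

lemma hinner_add_left: "hinner (u + v) w = hinner u w + hinner v w"
  and hinner_add_right: "hinner u (v + w) = hinner u v + hinner u w"
  and hinner_diff_right: "hinner u (v - w) = hinner u v - hinner u w"
  and hinner_smult_left: "hinner (z *s u) v = cnj z * hinner u v"
  by (simp_all add: hinner_def algebra_simps sum.distrib sum_subtractf sum_distrib_left)

lemma hinner_ctranspose: "hinner (A *v u) v = hinner u (ctranspose A *v v)"
proof -
  have "hinner (A *v u) v = (\<Sum>i\<in>UNIV. \<Sum>j\<in>UNIV. cnj (A $ i $ j) * cnj (u $ j) * v $ i)"
    by (simp add: hinner_def matrix_vector_mult_def sum_distrib_right)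
  also have "\<dots> = (\<Sum>j\<in>UNIV. \<Sum>i\<in>UNIV. cnj (A $ i $ j) * cnj (u $ j) * v $ i)"
    by (rule sum.swap)
  also have "\<dots> = hinner u (ctranspose A *v v)"
    by (simp add: hinner_def matrix_vector_mult_def ctranspose_def sum_distrib_left ac_simps)
  finally show ?thesis .
qed

section \<open>Cauchy-Schwarz and operator norm estimates\<close>

lemma norm_hinner_le: "cmod (hinner u v) \<le> norm u * norm v"
proof -
  have "cmod (hinner u v) \<le> (\<Sum>i\<in>UNIV. \<bar>cmod (u $ i)\<bar> * \<bar>cmod (v $ i)\<bar>)"
    unfolding hinner_def by (rule sum_norm_le) (simp add: norm_mult)
  also have "\<dots> \<le> norm u * norm v"
    unfolding norm_vec_def by (rule L2_set_mult_ineq)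
  finally show ?thesis .
qed

lemma norm_mult_vec_le: "norm (A *v x) \<le> mat_norm A * norm x"
  unfolding mat_norm_def by (rule onorm) simp

lemma mat_norm_nonneg: "0 \<le> mat_norm A"
  unfolding mat_norm_def by (rule onorm_pos_le) simp

lemma norm_entry_le_mat_norm: "cmod (A $ i $ j) \<le> mat_norm A"
proof -
  have "A $ i $ j = (A *v axis j 1) $ i"
    by (simp add: matrix_vector_mult_def axis_def if_distrib[of "\<lambda>z. _ * z"] cong: if_cong)
  also have "cmod \<dots> \<le> norm (A *v axis j 1)"
    by (rule Finite_Cartesian_Product.norm_nth_le)
  also have "\<dots> \<le> mat_norm A"
    using norm_mult_vec_le[of A "axis j 1"] by simp
  finally show ?thesis .
qed

lemma mat_norm_mult_le: "mat_norm (A ** B) \<le> mat_norm A * mat_norm B"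
  unfolding mat_norm_def
  using onorm_compose[of "(*v) A" "(*v) B"] by (simp add: o_def matrix_vector_mul_assoc)

lemma mat_norm_one_le: "mat_norm (mat 1) \<le> 1"
  unfolding mat_norm_def by (rule onorm_le) simp

lemma mat_norm_power_le: "mat_norm (mat_power A k) \<le> mat_norm A ^ k"
proof (induction k)
  case (Suc k)
  have "mat_norm (mat_power A (Suc k)) \<le> mat_norm A * mat_norm (mat_power A k)"
    by (simp add: mat_norm_mult_le)
  also have "\<dots> \<le> mat_norm A * mat_norm A ^ k"
    by (intro mult_left_mono Suc mat_norm_nonneg)
  finally show ?case by simp
qed (simp add: mat_norm_one_le)

text \<open>A crude comparison of the Frobenius norm with the operator norm. It lets bounds on
  \<open>mat_norm\<close> control limits and series, which are taken in the norm of the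
  type.\<close>

lemma norm_mat_le: "norm A \<le> real (CARD('m) * CARD('n)) * mat_norm A"
  for A :: "complex^'n^'m"
proof -
  have "norm A \<le> (\<Sum>i\<in>UNIV. norm (A $ i))"
    by (simp add: norm_vec_def L2_set_le_sum)
  also have "\<dots> \<le> (\<Sum>i\<in>(UNIV::'m set). \<Sum>j\<in>(UNIV::'n set). cmod (A $ i $ j))"
    by (intro sum_mono) (simp add: norm_vec_def L2_set_le_sum)
  also have "\<dots> \<le> (\<Sum>i\<in>(UNIV::'m set). \<Sum>j\<in>(UNIV::'n set). mat_norm A)"
    by (intro sum_mono norm_entry_le_mat_norm)
  finally show ?thesis by simp
qed

lemma matrix_add_rdistrib: "(A + B) ** C = A ** C + B ** C"
  for C :: "complex^'n^'m"
  by (simp add: vec_eq_iff matrix_matrix_mult_def algebra_simps sum.distrib)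

section \<open>Inverses and the Neumann series\<close>

lemma matrix_inv_unique:
  fixes A B :: "complex^'n^'n"
  assumes "A ** B = mat 1"
  shows "matrix_inv A = B"
proof -
  have "\<exists>X. A ** X = mat 1 \<and> X ** A = mat 1"
    using assms matrix_left_right_inverse[of A B] by blast
  then have "A ** matrix_inv A = mat 1 \<and> matrix_inv A ** A = mat 1"
    unfolding matrix_inv_def by (rule someI_ex)
  then show ?thesis
    using assms by (metis matrix_mul_assoc matrix_mul_lid matrix_mul_rid)
qed

lemma matrix_inv_inverse:
  fixes A :: "complex^'n^'n"
  assumes "invertible A"
  shows "A ** matrix_inv A = mat 1" "matrix_inv A ** A = mat 1"
proof -
  obtain B where B: "A ** B = mat 1" "B ** A = mat 1"
    using assms unfolding invertible_def by blast
  with matrix_inv_unique[OF B(1)]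
  show "A ** matrix_inv A = mat 1" "matrix_inv A ** A = mat 1" by auto
qed

text \<open>The series starts at the first power, as in \<open>M4\<close>, so the identity is split
  off. The partial products telescope, and the remainder vanishes because
  \<open>mat_norm K ^ k\<close> tends to 0.\<close>

lemma neumann_series:
  fixes K :: "complex^'n^'n"
  assumes "mat_norm K < 1"
  shows "(mat 1 + K) ** (mat 1 + (\<Sum>k. (-1) ^ Suc k *\<^sub>R mat_power K (Suc k))) = mat 1"
proof -
  let ?f = "\<lambda>k. (-1) ^ Suc k *\<^sub>R mat_power K (Suc k)"
  let ?c = "real (CARD('n) * CARD('n))"
  have bound: "norm (mat_power K k) \<le> ?c * mat_norm K ^ k" for k
  proof -
    have "norm (mat_power K k) \<le> ?c * mat_norm (mat_power K k)"
      by (rule norm_mat_le)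
    also have "\<dots> \<le> ?c * mat_norm K ^ k"
      by (intro mult_left_mono mat_norm_power_le) simp
    finally show ?thesis .
  qed
  have "summable (\<lambda>k. ?c * mat_norm K ^ k)"
    using assms mat_norm_nonneg[of K] by (intro summable_mult summable_geometric) simp
  then have c0: "(\<lambda>k. ?c * mat_norm K ^ k) \<longlonglongrightarrow> 0" and
    c1: "summable (\<lambda>k. ?c * mat_norm K ^ Suc k)"
    by (rule summable_LIMSEQ_zero) (subst summable_Suc_iff, fact)
  have p0: "(\<lambda>k. mat_power K k) \<longlonglongrightarrow> 0"
    by (rule Lim_null_comparison[OF always_eventually c0]) (use bound in blast)
  have "summable ?f"
  proof (rule summable_comparison_test'[OF c1])
    show "norm (?f k) \<le> ?c * mat_norm K ^ Suc k" for k
      using bound[of "Suc k"] by (simp add: power_abs)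
  qed
  then have "(\<lambda>n. \<Sum>k<n. ?f k) \<longlonglongrightarrow> (\<Sum>k. ?f k)"
    by (rule summable_LIMSEQ)
  moreover have "bounded_linear (\<lambda>X. (mat 1 + K) ** X)"
    unfolding linear_conv_bounded_linear[symmetric]
    by (rule linearI) (simp_all add: matrix_add_ldistrib matrix_scalar_ac scalar_matrix_assoc[symmetric])
  ultimately have lim: "(\<lambda>n. (mat 1 + K) ** (mat 1 + (\<Sum>k<n. ?f k)))
      \<longlonglongrightarrow> (mat 1 + K) ** (mat 1 + (\<Sum>k. ?f k))"
    by (intro bounded_linear.tendsto[where f = "\<lambda>X. (mat 1 + K) ** X"] tendsto_intros)
  \<comment> \<open>Only the last power survives the telescoping: n summands reach power n, hence
    the remainder has power \<open>Suc n\<close> and sign \<open>(-1) ^ n\<close>.\<close>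
  have partial: "(mat 1 + K) ** (mat 1 + (\<Sum>k<n. ?f k)) = mat 1 + (-1) ^ n *\<^sub>R mat_power K (Suc n)" for n
  proof (induction n)
    case (Suc n)
    have "(mat 1 + K) ** (mat 1 + (\<Sum>k<Suc n. ?f k))
        = (mat 1 + K) ** (mat 1 + (\<Sum>k<n. ?f k)) + (mat 1 + K) ** ?f n"
      by (simp only: sum.lessThan_Suc matrix_add_ldistrib add.assoc)
    also have "(mat 1 + K) ** ?f n
        = (-1) ^ Suc n *\<^sub>R mat_power K (Suc n) + (-1) ^ Suc n *\<^sub>R mat_power K (Suc (Suc n))"
      by (simp only: matrix_scalar_ac scalar_matrix_assoc[symmetric] matrix_add_rdistrib
          matrix_mul_lid mat_power.simps scaleR_add_right)
    finally show ?case
      unfolding Suc by simp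
  qed simp
  have "(\<lambda>n. (-1) ^ n *\<^sub>R mat_power K (Suc n)) \<longlonglongrightarrow> 0"
    by (rule tendsto_norm_zero_cancel)
      (use tendsto_norm_zero[OF LIMSEQ_Suc[OF p0]] in \<open>simp add: power_abs\<close>)
  then have "(\<lambda>n. mat 1 + (-1) ^ n *\<^sub>R mat_power K (Suc n)) \<longlonglongrightarrow> mat 1 + 0"
    by (intro tendsto_intros)
  with lim show ?thesis
    unfolding partial by (auto dest: LIMSEQ_unique)
qed

lemma two_rows_nth [simp]:
  "two_rows i j A $ 1 $ k = A $ i $ k" "two_rows i j A $ 2 $ k = A $ j $ k"
  by (simp_all add: two_rows_def row_def)

lemma two_rows_add: "two_rows i j (A + B) = two_rows i j A + two_rows i j B"
  by (simp add: vec_eq_iff forall_2)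

lemma two_rows_mult_vec: "two_rows i j A *v x = vector [(A *v x) $ i, (A *v x) $ j]"
  by (simp add: vec_eq_iff forall_2 matrix_vector_mult_def)

section \<open>The invariant Hermitian symplectic form\<close>

text \<open>The sesquilinear extension of the symplectic form pairing coordinate 1 with 3 and 2 with
  4. The sandwich plane is Lagrangian for it.\<close>

definition sform :: "complex^4 \<Rightarrow> complex^4 \<Rightarrow> complex" where
  "sform P Q = cnj (P $ 3) * Q $ 1 + cnj (P $ 4) * Q $ 2
             - cnj (P $ 1) * Q $ 3 - cnj (P $ 2) * Q $ 4"

lemma sform_add_right: "sform P (Q + Q') = sform P Q + sform P Q'"
  by (simp add: sform_def algebra_simps)

lemma sform_mult_vec:
  "sform (P *v \<xi>) (R *v \<gamma>) = hinner \<xi>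
     ((ctranspose (two_rows 3 4 P) ** two_rows 1 2 R
       - ctranspose (two_rows 1 2 P) ** two_rows 3 4 R) *v \<gamma>)"
proof -
  have "sform (P *v \<xi>) (R *v \<gamma>) = hinner (two_rows 3 4 P *v \<xi>) (two_rows 1 2 R *v \<gamma>)
      - hinner (two_rows 1 2 P *v \<xi>) (two_rows 3 4 R *v \<gamma>)"
    by (simp add: sform_def hinner_def sum_2 two_rows_mult_vec)
  then show ?thesis
    by (simp only: hinner_ctranspose hinner_diff_right matrix_vector_mult_diff_rdistrib
        matrix_vector_mul_assoc)
qed

lemma BmatC_mult_vec:
  "BmatC muh nuh \<phi> x *v q = vector
     [q $ 4, q $ 3 - 2 * q $ 4,
      complex_of_real (-1 + deriv (nonlin muh nuh) (\<phi> x)) * q $ 1, q $ 2]"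
  by (simp add: vec_eq_iff forall_4 matrix_vector_mult_def sum_4 BmatC_def Bmat_def
      map_matrix_def)

text \<open>The coefficient matrix is infinitesimally symplectic: in the derivative all products
  cancel in pairs. The varying entry occurs only with \<open>cnj (P x $ 1) * Q x $ 1\<close>, and
  cancels because it is real.\<close>

lemma sform_const:
  assumes P: "lin_solution (BmatC muh nuh \<phi>) P" and Q: "lin_solution (BmatC muh nuh \<phi>) Q"
  shows "sform (P x) (Q x) = sform (P y) (Q y)"
proof -
  have nth: "((\<lambda>x. F x $ i) has_vector_derivative (BmatC muh nuh \<phi> x *v F x) $ i) (at x)"
    if "lin_solution (BmatC muh nuh \<phi>) F" for F i x
    using that unfolding lin_solution_def
    by (intro bounded_linear.has_vector_derivative[OF bounded_linear_vec_nth]) blast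
  have prod: "((\<lambda>x. cnj (P x $ i) * Q x $ j) has_vector_derivative
      cnj (P x $ i) * (BmatC muh nuh \<phi> x *v Q x) $ j
      + cnj ((BmatC muh nuh \<phi> x *v P x) $ i) * Q x $ j) (at x)" for i j x
    by (intro has_vector_derivative_mult has_vector_derivative_cnj nth P Q)
  have "((\<lambda>x. sform (P x) (Q x)) has_vector_derivative 0) (at x)" for x
    unfolding sform_def
    using has_vector_derivative_diff[OF has_vector_derivative_diff[OF
        has_vector_derivative_add[OF prod[of 3 1] prod[of 4 2]] prod[of 1 3]] prod[of 2 4], of x]
    by (simp add: BmatC_mult_vec algebra_simps)
  then show ?thesis
    by (intro has_derivative_zero_unique[of UNIV "\<lambda>x. sform (P x) (Q x)"])
      (simp_all add: has_vector_derivative_def)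
qed

text \<open>A constant equals its limit, here \<open>sform 0 0\<close>. An arbitrary nontrivial
  filter serves both ends of the line.\<close>

lemma sform_eq_zero:
  assumes P: "lin_solution (BmatC muh nuh \<phi>) P" "(P \<longlongrightarrow> 0) F"
    and Q: "lin_solution (BmatC muh nuh \<phi>) Q" "(Q \<longlongrightarrow> 0) F"
    and F: "F \<noteq> bot"
  shows "sform (P x) (Q x) = 0"
proof -
  have "((\<lambda>y. sform (P y) (Q y)) \<longlongrightarrow> sform 0 0) F"
    unfolding sform_def by (intro tendsto_intros P Q)
  moreover have "(\<lambda>y. sform (P y) (Q y)) = (\<lambda>y. sform (P x) (Q x))"
    by (rule ext) (rule sform_const[OF P(1) Q(1)])
  ultimately have "((\<lambda>y. sform (P x) (Q x)) \<longlongrightarrow> sform 0 0) F"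
    by (simp only:)
  then show ?thesis
    using F by (simp add: tendsto_const_iff) (simp add: sform_def)
qed

lemma sform_Eu_minus:
  assumes "p \<in> Eu_minus (BmatC muh nuh \<phi>) x" "q \<in> Eu_minus (BmatC muh nuh \<phi>) x"
  shows "sform p q = 0"
  using assms by (auto simp: Eu_minus_def intro!: sform_eq_zero[of _ _ _ _ at_bot])

lemma sform_Es_plus:
  assumes "p \<in> Es_plus (BmatC muh nuh \<phi>) x" "q \<in> Es_plus (BmatC muh nuh \<phi>) x"
  shows "sform p q = 0"
  using assms by (auto simp: Es_plus_def intro!: sform_eq_zero[of _ _ _ _ at_top])

section \<open>Linear structure of the decaying subspaces, and passage from real to complex
  solutions\<close>

lemma bounded_linear_vector_smult: "bounded_linear (\<lambda>v. z *s v)" for z :: complex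
  unfolding linear_conv_bounded_linear[symmetric]
  by (rule linearI) (simp_all add: vec_eq_iff algebra_simps)

lemma Es_plus_add:
  fixes A :: "real \<Rightarrow> complex^'n^'n"
  assumes "p \<in> Es_plus A x" "q \<in> Es_plus A x"
  shows "p + q \<in> Es_plus A x"
proof -
  obtain P Q where P: "p = P x" "lin_solution A P" "(P \<longlongrightarrow> 0) at_top"
    and Q: "q = Q x" "lin_solution A Q" "(Q \<longlongrightarrow> 0) at_top"
    using assms by (auto simp: Es_plus_def)
  have "lin_solution A (\<lambda>x. P x + Q x)"
    using P(2) Q(2) unfolding lin_solution_def
    by (auto intro!: derivative_eq_intros simp: matrix_vector_right_distrib)
  moreover have "((\<lambda>x. P x + Q x) \<longlongrightarrow> 0) at_top"
    using tendsto_add[OF P(3) Q(3)] by simp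
  ultimately show ?thesis
    unfolding Es_plus_def P(1) Q(1) by (auto intro!: exI[of _ "\<lambda>x. P x + Q x"])
qed

lemma Es_plus_smult:
  fixes A :: "real \<Rightarrow> complex^'n^'n"
  assumes "p \<in> Es_plus A x"
  shows "z *s p \<in> Es_plus A x"
proof -
  obtain P where P: "p = P x" "lin_solution A P" "(P \<longlongrightarrow> 0) at_top"
    using assms by (auto simp: Es_plus_def)
  have "lin_solution A (\<lambda>x. z *s P x)"
    using P(2) unfolding lin_solution_def
    by (auto simp: vector_scalar_commute
        intro!: bounded_linear.has_vector_derivative[OF bounded_linear_vector_smult])
  moreover have "((\<lambda>x. z *s P x) \<longlongrightarrow> 0) at_top"
    using bounded_linear.tendsto[OF bounded_linear_vector_smult P(3)] by simp
  ultimately show ?thesis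
    unfolding Es_plus_def P(1) by (auto intro!: exI[of _ "\<lambda>x. z *s P x"])
qed

text \<open>At a fixed point the exponential is a nonzero scalar and can be divided out. So the
  columns of \<open>S + WS x\<close> lie in the stable space at x, although as functions of x they
  need not solve the system.\<close>

lemma Es_plus_exp_solution:
  fixes A :: "real \<Rightarrow> complex^'n^'n"
  assumes "Re \<mu> < 0" "lin_solution A (\<lambda>x. exp (\<mu> * complex_of_real x) *s (V + W x))"
    and "(W \<longlongrightarrow> 0) at_top"
  shows "V + W x \<in> Es_plus A x"
proof -
  have e: "((\<lambda>x. exp (\<mu> * complex_of_real x)) \<longlongrightarrow> 0) at_top"
  proof (rule tendsto_norm_zero_cancel)
    have "filterlim (\<lambda>x. Re \<mu> * x) at_bot at_top"
      using assms(1) by (simp add: filterlim_tendsto_neg_mult_at_bot[OF tendsto_const _ filterlim_ident])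
    then show "((\<lambda>x. cmod (exp (\<mu> * complex_of_real x))) \<longlongrightarrow> 0) at_top"
      by (simp add: filterlim_compose[OF exp_at_bot])
  qed
  have nth: "((\<lambda>x. (V + W x) $ i) \<longlongrightarrow> (V + 0) $ i) at_top" for i
    by (intro tendsto_intros assms(3))
  have "((\<lambda>x. exp (\<mu> * complex_of_real x) *s (V + W x)) \<longlongrightarrow> 0) at_top"
    by (rule vec_tendstoI) (use tendsto_mult[OF e nth] in \<open>simp add: distrib_left\<close>)
  with assms(2) have "exp (\<mu> * complex_of_real x) *s (V + W x) \<in> Es_plus A x"
    unfolding Es_plus_def by (intro CollectI exI conjI) (rule refl)
  from Es_plus_smult[OF this, of "inverse (exp (\<mu> * complex_of_real x))"] show ?thesis
    by (simp add: vector_smult_assoc)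
qed

text \<open>Conjugate points are defined by real solutions, whereas the bases are complex; since the
  coefficients are real, real solutions embed.\<close>

lemma Eu_minus_vec_of_real:
  assumes "v \<in> Eu_minus (Bmat muh nuh \<phi>) x"
  shows "vec_of_real v \<in> Eu_minus (BmatC muh nuh \<phi>) x"
proof -
  obtain Q where Q: "v = Q x" "lin_solution (Bmat muh nuh \<phi>) Q" "(Q \<longlongrightarrow> 0) at_bot"
    using assms by (auto simp: Eu_minus_def)
  have bl: "bounded_linear (vec_of_real :: real^4 \<Rightarrow> complex^4)"
    unfolding linear_conv_bounded_linear[symmetric]
    by (rule linearI) (simp_all add: vec_eq_iff vec_of_real_def scaleR_conv_of_real[where 'a = complex])
  have "vec_of_real (Bmat muh nuh \<phi> x *v q) = BmatC muh nuh \<phi> x *v vec_of_real q" for x q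
    by (simp add: vec_eq_iff vec_of_real_def BmatC_def map_matrix_def matrix_vector_mult_def)
  then have "lin_solution (BmatC muh nuh \<phi>) (\<lambda>x. vec_of_real (Q x))"
    using Q(2) bounded_linear.has_vector_derivative[OF bl] unfolding lin_solution_def
    by metis
  moreover have "((\<lambda>x. vec_of_real (Q x) :: complex^4) \<longlongrightarrow> 0) at_bot"
    using bounded_linear.tendsto[OF bl Q(3)] by (simp add: vec_of_real_def zero_vec_def)
  ultimately show ?thesis
    unfolding Eu_minus_def Q(1) by (auto intro!: exI[of _ "\<lambda>x. vec_of_real (Q x)"])
qed

section \<open>Hermitian matrices with constant diagonal\<close>

lemma ctranspose_mult: "ctranspose (A ** B) = ctranspose B ** ctranspose A"
  by (simp add: vec_eq_iff ctranspose_def matrix_matrix_mult_def mult.commute)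

lemma ctranspose_ctranspose [simp]: "ctranspose (ctranspose A) = A"
  by (simp add: vec_eq_iff ctranspose_def)

text \<open>Its eigenvalues are s + |n| and s - |n|, so \<open>cmod n \<le> \<bar>s\<bar>\<close>
  expresses semidefiniteness.\<close>

definition herm2 :: "real \<Rightarrow> complex \<Rightarrow> complex^2^2" where
  "herm2 s n = vector [vector [of_real s, n], vector [cnj n, of_real s]]"

lemma ctranspose_herm2: "ctranspose (herm2 s n) = herm2 s n"
  by (simp add: vec_eq_iff forall_2 ctranspose_def herm2_def)

lemma herm2_square_mult_vec:
  "(herm2 s n ** herm2 s n) *v v = vector
     [of_real (s\<^sup>2 + (cmod n)\<^sup>2) * v $ 1 + 2 * of_real s * n * v $ 2,
      2 * of_real s * cnj n * v $ 1 + of_real (s\<^sup>2 + (cmod n)\<^sup>2) * v $ 2]"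
  unfolding of_real_add complex_norm_square
  by (simp add: vec_eq_iff forall_2 matrix_vector_mult_def matrix_matrix_mult_def sum_2
      herm2_def algebra_simps power2_eq_square)

text \<open>The matrix in \<open>sigma_min\<close> is the square of \<open>herm2 s n\<close>, with
  eigenvalues (s + |n|)^2 and (s - |n|)^2. The smaller of these is shown to be attained.\<close>

lemma sigma_min_le:
  assumes "ctranspose B ** A = herm2 s n"
  shows "sigma_min A B \<le> \<bar>\<bar>s\<bar> - cmod n\<bar>"
proof -
  let ?D = "complex_of_real (s\<^sup>2 + (cmod n)\<^sup>2)" and ?H = "herm2 s n ** herm2 s n"
  define Z where "Z = {z. mat_eigenvalue ?H z}"
  have "ctranspose A ** B = herm2 s n"
    using arg_cong[OF assms, of ctranspose] by (simp add: ctranspose_mult ctranspose_herm2)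
  then have H: "ctranspose A ** B ** ctranspose B ** A = ?H"
    by (metis assms matrix_mul_assoc)
  \<comment> \<open>Finiteness of the spectrum is required before \<open>Min\<close> says anything.
    Eliminating either coordinate of an eigenvector leaves the characteristic equation times the
    other.\<close>
  have "Z \<subseteq> {?D + 2 * of_real s * of_real (cmod n), ?D - 2 * of_real s * of_real (cmod n)}"
  proof
    fix z assume "z \<in> Z"
    then obtain v where "v \<noteq> 0" and v: "?H *v v = z *s v"
      unfolding Z_def mat_eigenvalue_def by blast
    have e: "?D * v $ 1 + 2 * of_real s * n * v $ 2 = z * v $ 1"
      "2 * of_real s * cnj n * v $ 1 + ?D * v $ 2 = z * v $ 2"
      using v[unfolded herm2_square_mult_vec] by (simp_all add: vec_eq_iff forall_2)
    have n: "n * cnj n = (of_real (cmod n))\<^sup>2"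
      by (simp add: complex_norm_square[symmetric])
    have "((z - ?D)\<^sup>2 - (2 * of_real s * of_real (cmod n))\<^sup>2) * v $ 1 = 0"
      "((z - ?D)\<^sup>2 - (2 * of_real s * of_real (cmod n))\<^sup>2) * v $ 2 = 0"
      using e n by algebra+
    moreover have "v $ 1 \<noteq> 0 \<or> v $ 2 \<noteq> 0"
      using \<open>v \<noteq> 0\<close> by (simp add: vec_eq_iff forall_2)
    ultimately have "(z - ?D)\<^sup>2 = (2 * of_real s * of_real (cmod n))\<^sup>2"
      by auto
    then have "z - ?D = 2 * of_real s * of_real (cmod n) \<or> z - ?D = - (2 * of_real s * of_real (cmod n))"
      by (simp only: power2_eq_iff)
    then show "z \<in> {?D + 2 * of_real s * of_real (cmod n), ?D - 2 * of_real s * of_real (cmod n)}"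
      by (auto simp only: diff_eq_eq insert_iff add.commute uminus_add_conv_diff)
  qed
  then have "finite Z"
    by (rule finite_subset) simp
  then have "finite {sqrt (cmod z) | z. mat_eigenvalue ?H z}"
    by (simp add: Z_def setcompr_eq_image)
  moreover have "mat_eigenvalue ?H (of_real ((\<bar>s\<bar> - cmod n)\<^sup>2))"
  proof (cases "n = 0")
    case True
    then show ?thesis
      unfolding mat_eigenvalue_def herm2_square_mult_vec
      by (intro exI[of _ "vector [1, 0]"]) (simp add: vec_eq_iff forall_2)
  next
    case False
    \<comment> \<open>The sign selects the eigenvalue s + \<epsilon>|n| of smaller modulus. Its
      eigenvector (n, \<epsilon>|n|) degenerates for n = 0, hence the case split.\<close>
    define \<epsilon> :: real where "\<epsilon> = (if s \<ge> 0 then -1 else 1)"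
    have \<epsilon>: "(\<bar>s\<bar> - cmod n)\<^sup>2 = s\<^sup>2 + (cmod n)\<^sup>2 + 2 * \<epsilon> * s * cmod n" "\<epsilon> * \<epsilon> = 1"
      by (auto simp: \<epsilon>_def power2_eq_square algebra_simps abs_if)
    have n: "n * cnj n = (of_real (cmod n))\<^sup>2"
      by (simp add: complex_norm_square[symmetric])
    have \<epsilon>': "complex_of_real \<epsilon> * of_real \<epsilon> = 1"
      using \<epsilon>(2) by (metis of_real_1 of_real_mult)
    show ?thesis
      unfolding mat_eigenvalue_def herm2_square_mult_vec \<epsilon>(1)
    proof (intro exI[of _ "vector [n, of_real (\<epsilon> * cmod n)]"] conjI)
      show "vector [n, of_real (\<epsilon> * cmod n)] \<noteq> (0 :: complex^2)"
        using False by (simp add: vec_eq_iff forall_2)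
    qed (use n \<epsilon>' in \<open>simp add: vec_eq_iff forall_2, algebra\<close>)
  qed
  then have "\<bar>\<bar>s\<bar> - cmod n\<bar> \<in> {sqrt (cmod z) | z. mat_eigenvalue ?H z}"
    by (intro CollectI exI[of _ "of_real ((\<bar>s\<bar> - cmod n)\<^sup>2)"]) (simp del: of_real_power)
  ultimately show ?thesis
    unfolding sigma_min_def H by (rule Min_le)
qed

text \<open>The diagonal contributes s|v|^2, and the off-diagonal part is at most 2|n||v1||v2|,
  hence at most |n||v|^2.\<close>

lemma hinner_herm2_ge:
  "(\<bar>s\<bar> - cmod n) * (norm v)\<^sup>2 \<le> cmod (hinner v (herm2 s n *v v))"
proof -
  let ?a = "cmod (v $ 1)" and ?b = "cmod (v $ 2)" and ?y = "cnj (v $ 1) * n * v $ 2"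
  have norm: "(norm v)\<^sup>2 = ?a\<^sup>2 + ?b\<^sup>2"
    by (simp add: norm_vec_def L2_set_def sum_2)
  have "hinner v (herm2 s n *v v) = of_real (s * (norm v)\<^sup>2) + (?y + cnj ?y)"
    unfolding norm of_real_mult of_real_add complex_norm_square
    by (simp add: hinner_def sum_2 matrix_vector_mult_def herm2_def algebra_simps)
  then have "cmod (of_real (s * (norm v)\<^sup>2)) - cmod (?y + cnj ?y) \<le> cmod (hinner v (herm2 s n *v v))"
    by (simp only: norm_diff_ineq)
  moreover have "cmod (?y + cnj ?y) \<le> cmod n * (norm v)\<^sup>2"
  proof -
    have "cmod (?y + cnj ?y) \<le> cmod ?y + cmod (cnj ?y)"
      by (rule norm_triangle_ineq)
    also have "\<dots> = cmod n * (2 * ?a * ?b)"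
      by (simp add: norm_mult)
    also have "\<dots> \<le> cmod n * (norm v)\<^sup>2"
      unfolding norm by (intro mult_left_mono sum_squares_bound) simp
    finally show ?thesis .
  qed
  ultimately show ?thesis
    by (simp only: norm_of_real abs_mult abs_power2 power_abs[symmetric] abs_norm_cancel left_diff_distrib)
qed

section \<open>The eigenvector matrices\<close>

text \<open>With \<open>r\<close> the inverse of an eigenvalue of the asymptotic matrix, \<open>eigvec r\<close> is its
  eigenvector; so one parameter \<open>r\<close> gives the unstable matrix \<open>eigmat r\<close> and the stable
  matrix \<open>eigmat (- r)\<close>.\<close>

definition eigvec :: "complex \<Rightarrow> complex^4" where
  "eigvec r = vector [r\<^sup>2, 1, 1 / r + 2 * r, r]"

definition eigmat :: "complex \<Rightarrow> complex^2^4" where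
  "eigmat r = col_mat (\<lambda>j. if j = 1 then eigvec r else vec_cnj (eigvec r))"

lemma eigmat_nth [simp]:
  "eigmat r $ 1 $ 1 = r\<^sup>2" "eigmat r $ 1 $ 2 = (cnj r)\<^sup>2"
  "eigmat r $ 2 $ 1 = 1" "eigmat r $ 2 $ 2 = 1"
  "eigmat r $ 3 $ 1 = 1 / r + 2 * r" "eigmat r $ 3 $ 2 = 1 / cnj r + 2 * cnj r"
  "eigmat r $ 4 $ 1 = r" "eigmat r $ 4 $ 2 = cnj r"
  by (simp_all add: eigmat_def col_mat_def eigvec_def vec_cnj_def)

text \<open>Rows 1 and 2 are even in r, rows 3 and 4 odd.\<close>

lemma eigmat_uminus:
  "two_rows 1 2 (eigmat (- r)) = two_rows 1 2 (eigmat r)"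
  "two_rows 3 4 (eigmat (- r)) = - two_rows 3 4 (eigmat r)"
  by (simp_all add: vec_eq_iff forall_2)

text \<open>Cramer's rule: the determinant of rows 1 and 4 is r q (r - q), nonzero because r is not
  real.\<close>

lemma eigmat_right_inverse:
  fixes r :: complex
  defines "q \<equiv> cnj r"
  assumes "r \<noteq> q"
  shows "two_rows 1 4 (eigmat r) ** vector
     [vector [1 / (r * (r - q)), - q / (r * (r - q))],
      vector [- 1 / (q * (r - q)), r / (q * (r - q))]] = mat 1" (is "_ ** ?X = _")
proof -
  have nz: "r \<noteq> 0" "q \<noteq> 0" "r - q \<noteq> 0"
    using assms by auto
  show ?thesis
    using nz by (simp add: vec_eq_iff forall_2 matrix_matrix_mult_def sum_2 mat_def q_def[symmetric])
      (simp add: divide_simps; simp add: algebra_simps power2_eq_square)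
qed

lemma invertible_eigmat:
  assumes "r \<noteq> cnj r"
  shows "invertible (two_rows 1 4 (eigmat r))"
  using eigmat_right_inverse[OF assms] by (auto simp: invertible_right_inverse)

lemma M2_eigmat:
  fixes r :: complex
  defines "q \<equiv> cnj r"
  assumes "r \<noteq> q"
  shows "M2 (eigmat (- r)) (eigmat r) = vector
     [vector [(r + q) / (r - q), 2 * q\<^sup>2 / (r * (r - q))],
      vector [- 2 * r\<^sup>2 / (q * (r - q)), - (r + q) / (r - q)]]"
proof -
  have nz: "r \<noteq> 0" "q \<noteq> 0" "r - q \<noteq> 0" "- r - - q \<noteq> 0"
    using assms by auto
  have "- r \<noteq> cnj (- r)"
    using assms by auto
  from matrix_inv_unique[OF eigmat_right_inverse[OF this]] show ?thesis
    unfolding M2_def using nz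
    by (simp add: vec_eq_iff forall_2 matrix_matrix_mult_def sum_2 q_def[symmetric])
      (simp add: divide_simps; simp add: algebra_simps power2_eq_square)
qed

text \<open>The hypothesis \<open>key\<close> says Re(r^2) = -|r|^4. Both diagonal entries are
  multiples of its left-hand side and therefore vanish.\<close>

lemma M1_eigmat:
  fixes r :: complex
  defines "q \<equiv> cnj r"
  assumes "r \<noteq> q" and key: "r\<^sup>2 + q\<^sup>2 + 2 * r\<^sup>2 * q\<^sup>2 = 0"
  shows "M1 (eigmat (- r)) (eigmat r) = vector
     [vector [0, - 4 * q * (1 + q\<^sup>2)], vector [- 4 * r * (1 + r\<^sup>2), 0]]"
proof -
  have nz: "r \<noteq> 0" "q \<noteq> 0" and cq: "cnj q = r"
    using assms by auto
  have "(1 / q + 2 * q) * r\<^sup>2 + q + (1 / r + 2 * r) * q\<^sup>2 + r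
      = (r + q) * (r\<^sup>2 + q\<^sup>2 + 2 * r\<^sup>2 * q\<^sup>2) / (r * q)"
    using nz by (simp add: divide_simps; simp add: algebra_simps power2_eq_square)
  then have "(1 / q + 2 * q) * r\<^sup>2 + q + (1 / r + 2 * r) * q\<^sup>2 + r = 0"
    by (simp add: key)
  then have "q + (r + (q\<^sup>2 * (1 / r + 2 * r) + r\<^sup>2 * (1 / q + 2 * q))) = 0"
    by (simp add: ac_simps)
  with nz show ?thesis
    unfolding M1_def eigmat_uminus
    by (simp add: vec_eq_iff forall_2 matrix_matrix_mult_def sum_2 ctranspose_def cq q_def[symmetric])
      (simp add: neg_eq_iff_add_eq_0 algebra_simps power2_eq_square)
qed

text \<open>The witnesses satisfy s = 8 Re r and |n|^2 = 32 (1 - |r|^2) (Re r)^2, whence |n|^2 is at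
  most s^2.\<close>

lemma M2_ctranspose_M1_eigmat:
  fixes r :: complex
  defines "q \<equiv> cnj r"
  assumes "r \<noteq> q" and key: "r\<^sup>2 + q\<^sup>2 + 2 * r\<^sup>2 * q\<^sup>2 = 0"
  obtains s n where
    "ctranspose (M2 (eigmat (- r)) (eigmat r)) ** M1 (eigmat (- r)) (eigmat r) = herm2 s n"
    "cmod n \<le> \<bar>s\<bar>"
proof
  \<comment> \<open>The (1,2) entry of the product: since \<open>M1\<close> has zero diagonal, it is
    the conjugate of the (1,1) entry of \<open>M2\<close> times the (1,2) entry of
    \<open>M1\<close>.\<close>
  define n where "n = - 4 * q * (1 + q\<^sup>2) * (r + q) / (q - r)"
  have nz: "r \<noteq> 0" "q \<noteq> 0" "r - q \<noteq> 0" "q - r \<noteq> 0" and cq: "cnj q = r"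
    using assms by auto
  have "r + q = of_real (2 * Re r)"
    unfolding q_def by (rule complex_add_cnj)
  then have s: "of_real (8 * Re r) = 4 * (r + q)" by simp
  have e: "8 * (q\<^sup>2 * (1 + r\<^sup>2)) / (q - r) = 4 * r + 4 * q"
    "- (8 * (r\<^sup>2 * (1 + q\<^sup>2)) / (q - r)) = 4 * r + 4 * q"
    "(- q - r) * z / (q - r) = z * (q + r) / (r - q)" for z
  proof -
    have "8 * (q\<^sup>2 * (1 + r\<^sup>2)) = (4 * r + 4 * q) * (q - r)"
      "- (8 * (r\<^sup>2 * (1 + q\<^sup>2))) = (4 * r + 4 * q) * (q - r)"
      using key by algebra+
    with nz show "8 * (q\<^sup>2 * (1 + r\<^sup>2)) / (q - r) = 4 * r + 4 * q"
      "- (8 * (r\<^sup>2 * (1 + q\<^sup>2)) / (q - r)) = 4 * r + 4 * q"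
      by (simp_all only: minus_divide_left divide_eq_eq not_False_eq_True if_True)
    show "(- q - r) * z / (q - r) = z * (q + r) / (r - q)"
      using nz by (simp add: divide_simps; simp add: algebra_simps)
  qed
  show "ctranspose (M2 (eigmat (- r)) (eigmat r)) ** M1 (eigmat (- r)) (eigmat r)
      = herm2 (8 * Re r) n"
    unfolding M1_eigmat[OF assms(2,3)[unfolded q_def]] M2_eigmat[OF assms(2)[unfolded q_def]]
      q_def[symmetric] herm2_def s
    using nz e by (simp add: vec_eq_iff forall_2 matrix_matrix_mult_def sum_2 ctranspose_def
      cq q_def[symmetric] n_def)
  let ?N = "(cmod r)\<^sup>2"
  have N: "complex_of_real ?N = r * q"
    unfolding q_def by (rule complex_norm_square)
  \<comment> \<open>As q - r is purely imaginary, -(q - r)^2 is |q - r|^2, which clears the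
    denominator of |n|^2. By \<open>key\<close> it equals 2|r|^2 (1 + |r|^2), and the factor 1 +
    |r|^2 also divides 1 - |r|^4.\<close>
  have "of_real ((cmod n)\<^sup>2) * (- (q - r)\<^sup>2)
      = 16 * (r * q) * ((1 + q\<^sup>2) * (1 + r\<^sup>2)) * (r + q)\<^sup>2"
    unfolding complex_norm_square n_def using nz
    by (simp add: cq q_def[symmetric]) (simp add: divide_simps; simp add: algebra_simps power2_eq_square)
  also have "(1 + q\<^sup>2) * (1 + r\<^sup>2) = 1 - (r * q)\<^sup>2"
    using key by algebra
  also have "- (q - r)\<^sup>2 = 2 * (r * q) * (1 + r * q)"
    using key by algebra
  finally have "complex_of_real ((cmod n)\<^sup>2 * (2 * ?N * (1 + ?N)))
      = of_real (16 * ?N * (1 - ?N\<^sup>2) * (2 * Re r)\<^sup>2)"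
    unfolding \<open>r + q = of_real (2 * Re r)\<close> N[symmetric] by simp
  then have "(cmod n)\<^sup>2 * (2 * ?N * (1 + ?N)) = 16 * ?N * (1 - ?N\<^sup>2) * (2 * Re r)\<^sup>2"
    by (simp only: of_real_eq_iff)
  also have "\<dots> = (32 * (1 - ?N) * (Re r)\<^sup>2) * (2 * ?N * (1 + ?N))"
    by (simp add: algebra_simps power2_eq_square)
  finally have "(cmod n)\<^sup>2 = 32 * (1 - ?N) * (Re r)\<^sup>2"
    using nz add_pos_nonneg[of 1 ?N] by (simp del: mult_cancel_right add: mult_right_cancel)
  also have "\<dots> \<le> (8 * Re r)\<^sup>2"
  proof -
    have "32 * (1 - ?N) \<le> 64"
      by (simp add: algebra_simps order_trans[of _ 0])
    from mult_right_mono[OF this zero_le_power2] show ?thesis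
      by (simp add: power_mult_distrib)
  qed
  finally show "cmod n \<le> \<bar>8 * Re r\<bar>"
    by (metis abs_le_square_iff abs_norm_cancel)
qed

section \<open>The criterion\<close>

text \<open>J inverts rows 1 and 4 of \<open>S + WS\<close>: these are rows 1 and 4 of S times the
  identity plus a contraction. Expanding J by the Neumann series, \<open>M2\<close> is the leading
  term and \<open>M4\<close> collects the rest.\<close>

lemma remainder_factor:
  assumes inv: "invertible (two_rows 1 4 S)" "invertible (two_rows 1 4 U)"
    and K: "mat_norm (matrix_inv (two_rows 1 4 S) ** two_rows 1 4 WS) < 1"
  obtains J where "J ** two_rows 1 4 (S + WS) = mat 1"
    "J ** two_rows 1 4 (U + WU) = M2 S U + M4 S U WS WU"
proof
  let ?K = "matrix_inv (two_rows 1 4 S) ** two_rows 1 4 WS"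
  let ?\<Sigma> = "\<Sum>k. (-1) ^ Suc k *\<^sub>R mat_power ?K (Suc k)"
  let ?J = "(mat 1 + ?\<Sigma>) ** matrix_inv (two_rows 1 4 S)"
  note S = matrix_inv_inverse[OF inv(1)] and U = matrix_inv_inverse[OF inv(2)]
  have "matrix_inv (two_rows 1 4 S) ** two_rows 1 4 (S + WS) = mat 1 + ?K"
    by (simp only: two_rows_add matrix_add_ldistrib S)
  moreover have "(mat 1 + ?\<Sigma>) ** (mat 1 + ?K) = mat 1"
    using neumann_series[OF K] by (simp only: matrix_left_right_inverse)
  ultimately show "?J ** two_rows 1 4 (S + WS) = mat 1"
    by (simp only: matrix_mul_assoc[symmetric])
  have "two_rows 1 4 (U + WU)
      = two_rows 1 4 U ** (mat 1 + matrix_inv (two_rows 1 4 U) ** two_rows 1 4 WU)"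
    by (simp only: two_rows_add matrix_add_ldistrib matrix_mul_assoc U matrix_mul_lid matrix_mul_rid)
  then have "?J ** two_rows 1 4 (U + WU) = (mat 1 + ?\<Sigma>) **
      (M2 S U ** (mat 1 + matrix_inv (two_rows 1 4 U) ** two_rows 1 4 WU))"
    by (simp only: M2_def matrix_mul_assoc)
  also have "\<dots> = M2 S U ** (mat 1 + matrix_inv (two_rows 1 4 U) ** two_rows 1 4 WU)
      + ?\<Sigma> ** M2 S U ** (mat 1 + matrix_inv (two_rows 1 4 U) ** two_rows 1 4 WU)"
    by (simp only: matrix_add_rdistrib matrix_mul_lid matrix_mul_assoc)
  also have "\<dots> = M2 S U + M4 S U WS WU"
    by (simp only: M4_def matrix_add_ldistrib[of "M2 S U" "mat 1"] matrix_mul_rid matrix_mul_assoc add.assoc)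
  finally show "?J ** two_rows 1 4 (U + WU) = M2 S U + M4 S U WS WU" .
qed

text \<open>The parity relations turn the term pairing rows 1, 2 of S with rows 3, 4 of U into the
  second summand of \<open>M1\<close>. Every term containing a remainder goes into
  \<open>M3\<close>.\<close>

lemma symplectic_M1_M3:
  assumes "two_rows 1 2 S = two_rows 1 2 U" "two_rows 3 4 S = - two_rows 3 4 U"
  shows "sform ((S + WS) *v \<xi>) ((U + WU) *v \<gamma>) = hinner \<xi> ((M1 S U + M3 S U WS WU) *v \<gamma>)"
proof -
  have "ctranspose (two_rows 3 4 (S + WS)) ** two_rows 1 2 (U + WU)
       - ctranspose (two_rows 1 2 (S + WS)) ** two_rows 3 4 (U + WU) = M1 S U + M3 S U WS WU"
    unfolding M1_def M3_def assms two_rows_add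
    by (simp add: vec_eq_iff matrix_matrix_mult_def ctranspose_def sum_2 algebra_simps)
  then show ?thesis
    by (simp only: sform_mult_vec)
qed

text \<open>This replaces a dimension count. The stable space is isotropic and contains the range of
  P, which surjects onto coordinates 1 and 4. After matching those coordinates, the difference d
  lies in the sandwich plane, and pairing it with suitable \<open>P *v \<eta>\<close> kills its
  other two.\<close>

lemma Es_plus_eq_mult_vec:
  assumes P: "\<And>\<xi>. P *v \<xi> \<in> Es_plus (BmatC muh nuh \<phi>) x"
    and inv: "invertible (two_rows 1 4 P)"
    and p: "p \<in> Es_plus (BmatC muh nuh \<phi>) x"
  obtains \<xi> where "p = P *v \<xi>"
proof
  have surj: "\<exists>\<xi>. (P *v \<xi>) $ 1 = a \<and> (P *v \<xi>) $ 4 = b" for a b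
  proof -
    obtain J where "two_rows 1 4 P ** J = mat 1"
      using inv by (auto simp: invertible_def)
    then have "two_rows 1 4 P *v (J *v vector [a, b]) = vector [a, b]"
      by (simp add: matrix_vector_mul_assoc)
    then show ?thesis
      by (auto simp: two_rows_mult_vec vec_eq_iff forall_2)
  qed
  obtain \<xi> where \<xi>: "(P *v \<xi>) $ 1 = p $ 1" "(P *v \<xi>) $ 4 = p $ 4"
    using surj by blast
  define d where "d = p + (-1) *s (P *v \<xi>)"
  have "d \<in> Es_plus (BmatC muh nuh \<phi>) x"
    unfolding d_def by (intro Es_plus_add Es_plus_smult p P)
  then have d: "sform d (P *v \<eta>) = 0" for \<eta>
    using sform_Es_plus P by blast
  have d14: "d $ 1 = 0" "d $ 4 = 0"
    by (simp_all add: d_def \<xi>)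
  obtain \<eta> where "(P *v \<eta>) $ 1 = 1" "(P *v \<eta>) $ 4 = 0"
    using surj by blast
  with d[of \<eta>] d14 have d3: "d $ 3 = 0"
    by (simp add: sform_def)
  obtain \<eta> where "(P *v \<eta>) $ 1 = 0" "(P *v \<eta>) $ 4 = 1"
    using surj by blast
  with d[of \<eta>] d14 have d2: "d $ 2 = 0"
    by (simp add: sform_def)
  have "d = 0"
    using d14 d2 d3 by (simp add: vec_eq_iff forall_4)
  then have "p = P *v \<xi>"
    by (simp add: d_def vec_eq_iff)
  then show "p = P *v (SOME \<xi>. p = P *v \<xi>)"
    by (rule someI)
qed

text \<open>This contradicts the strict inequality of the criterion. Orthogonality moves everything
  except the pairing of \<open>M2 *v \<gamma>\<close> with \<open>M1 *v \<gamma>\<close> to the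
  other side, where Cauchy-Schwarz applies; division by |\<gamma>|^2 creates the quotient
  |\<beta>|/|\<gamma>|.\<close>

lemma sigma_min_bound:
  fixes \<beta> \<gamma> :: "complex^2"
  assumes herm: "ctranspose (M2 S U) ** M1 S U = herm2 s n" "cmod n \<le> \<bar>s\<bar>"
    and orth: "hinner (\<beta> + (M2 S U + M4 S U WS WU) *v \<gamma>) ((M1 S U + M3 S U WS WU) *v \<gamma>) = 0"
    and \<gamma>: "\<gamma> \<noteq> 0"
  shows "sigma_min (M1 S U) (M2 S U) \<le>
    (mat_norm (M1 S U) + mat_norm (M3 S U WS WU))
      * (norm \<beta> * inverse (norm \<gamma>) + mat_norm (M4 S U WS WU))
    + mat_norm (M2 S U) * mat_norm (M3 S U WS WU)"
proof -
  define A where "A = M1 S U"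
  define B where "B = M2 S U"
  define C where "C = M3 S U WS WU"
  define D where "D = M4 S U WS WU"
  let ?u = "\<beta> + D *v \<gamma>" and ?w = "A *v \<gamma> + C *v \<gamma>" and ?g = "norm \<gamma>"
  \<comment> \<open>Semidefiniteness removes the outer absolute value in
    \<open>sigma_min_le\<close>, so the spectral bound meets the lower bound of the quadratic
    form.\<close>
  have "sigma_min A B * ?g\<^sup>2 \<le> (\<bar>s\<bar> - cmod n) * ?g\<^sup>2"
    using sigma_min_le[OF herm(1)] herm(2) unfolding A_def B_def
    by (intro mult_right_mono) simp_all
  also have "\<dots> \<le> cmod (hinner (B *v \<gamma>) (A *v \<gamma>))"
    using hinner_herm2_ge[of s n \<gamma>]
    by (simp add: hinner_ctranspose matrix_vector_mul_assoc herm(1) A_def B_def)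
  also have "hinner (B *v \<gamma>) (A *v \<gamma>) = - (hinner ?u ?w + hinner (B *v \<gamma>) (C *v \<gamma>))"
  proof -
    have "hinner (?u + B *v \<gamma>) ?w = 0"
      using orth by (simp add: A_def B_def C_def D_def matrix_vector_mult_add_rdistrib ac_simps)
    then show ?thesis
      by (simp add: hinner_add_left hinner_add_right) algebra
  qed
  also have "cmod (- (hinner ?u ?w + hinner (B *v \<gamma>) (C *v \<gamma>)))
      \<le> norm ?u * norm ?w + norm (B *v \<gamma>) * norm (C *v \<gamma>)"
    unfolding norm_minus_cancel by (intro norm_triangle_mono norm_hinner_le)
  also have "\<dots> \<le> (norm \<beta> + mat_norm D * ?g) * (mat_norm A * ?g + mat_norm C * ?g)
      + (mat_norm B * ?g) * (mat_norm C * ?g)"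
    by (intro add_mono mult_mono norm_triangle_mono norm_mult_vec_le order_refl
        add_nonneg_nonneg mult_nonneg_nonneg mat_norm_nonneg norm_ge_zero)
  also have "\<dots> = ((mat_norm A + mat_norm C) * (norm \<beta> * inverse ?g + mat_norm D)
      + mat_norm B * mat_norm C) * ?g\<^sup>2"
    using \<gamma> by (simp add: field_simps power2_eq_square)
  finally show ?thesis
    using \<gamma> by (simp add: A_def B_def C_def D_def)
qed

text \<open>The argument at a single point. If b is nonzero, \<beta> + (M2 + M4)\<gamma> is a
  multiple of \<alpha>, so it inherits the orthogonality of \<alpha> and violates the
  criterion.\<close>

lemma sandwich_zero:
  fixes \<beta> \<gamma> \<alpha> :: "complex^2"
  assumes S: "two_rows 1 2 S = two_rows 1 2 U" "two_rows 3 4 S = - two_rows 3 4 U"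
    and inv: "invertible (two_rows 1 4 S)" "invertible (two_rows 1 4 U)"
    and K: "mat_norm (matrix_inv (two_rows 1 4 S) ** two_rows 1 4 WS) < 1"
    and herm: "ctranspose (M2 S U) ** M1 S U = herm2 s n" "cmod n \<le> \<bar>s\<bar>"
    and \<gamma>: "\<gamma> \<noteq> 0"
    and Es: "\<And>\<xi>. (S + WS) *v \<xi> \<in> Es_plus (BmatC muh nuh \<phi>) x"
    and Eu: "(S + WS) *v \<alpha> \<in> Eu_minus (BmatC muh nuh \<phi>) x"
      "(S + WS) *v \<beta> + (U + WU) *v \<gamma> \<in> Eu_minus (BmatC muh nuh \<phi>) x"
    and sigma: "sigma_min (M1 S U) (M2 S U) >
      (mat_norm (M1 S U) + mat_norm (M3 S U WS WU))
        * (norm \<beta> * inverse (norm \<gamma>) + mat_norm (M4 S U WS WU))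
      + mat_norm (M2 S U) * mat_norm (M3 S U WS WU)"
    and v: "v = a *s ((S + WS) *v \<alpha>) + b *s ((S + WS) *v \<beta> + (U + WU) *v \<gamma>)"
    and sand: "v $ 1 = 0" "v $ 4 = 0"
  shows "v = 0"
proof -
  obtain J where J: "J ** two_rows 1 4 (S + WS) = mat 1"
    "J ** two_rows 1 4 (U + WU) = M2 S U + M4 S U WS WU"
    using remainder_factor[OF inv K] by blast
  let ?\<eta> = "a *s \<alpha> + b *s \<beta>" and ?M = "M2 S U + M4 S U WS WU"
  have v': "v = (S + WS) *v ?\<eta> + (U + WU) *v (b *s \<gamma>)"
    by (simp add: v vector_scalar_commute matrix_vector_right_distrib vec.scale_right_distrib)
  then have "two_rows 1 4 (S + WS) *v ?\<eta> + two_rows 1 4 (U + WU) *v (b *s \<gamma>) = vector [v $ 1, v $ 4]"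
    by (simp add: two_rows_mult_vec vec_eq_iff forall_2)
  also have "\<dots> = 0"
    by (simp add: sand vec_eq_iff forall_2)
  finally have "J *v (two_rows 1 4 (S + WS) *v ?\<eta> + two_rows 1 4 (U + WU) *v (b *s \<gamma>)) = 0"
    by simp
  then have \<eta>: "?\<eta> + ?M *v (b *s \<gamma>) = 0"
    by (simp only: matrix_vector_right_distrib matrix_vector_mul_assoc J matrix_vector_mul_lid)
  have "b = 0"
  proof (rule ccontr)
    assume "b \<noteq> 0"
    \<comment> \<open>Isotropy at minus infinity kills the pairing with the whole second vector,
      isotropy at plus infinity its \<beta>-part.\<close>
    have "sform ((S + WS) *v \<alpha>) ((U + WU) *v \<gamma>) = 0"
      using sform_Eu_minus[OF Eu] sform_Es_plus[OF Es[of \<alpha>] Es[of \<beta>]]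
      by (simp add: sform_add_right)
    then have orth: "hinner \<alpha> ((M1 S U + M3 S U WS WU) *v \<gamma>) = 0"
      by (simp add: symplectic_M1_M3[OF S])
    have "b *s (\<beta> + ?M *v \<gamma>) = - (a *s \<alpha>)"
      using \<eta> by (simp add: vector_scalar_commute vec.scale_right_distrib eq_neg_iff_add_eq_0 ac_simps)
    then have "\<beta> + ?M *v \<gamma> = (- (a / b)) *s \<alpha>"
      using \<open>b \<noteq> 0\<close> by (simp add: vec_eq_iff field_simps)
    then have "hinner (\<beta> + ?M *v \<gamma>) ((M1 S U + M3 S U WS WU) *v \<gamma>) = 0"
      by (simp only: hinner_smult_left orth mult_zero_right)
    from sigma_min_bound[OF herm this \<gamma>] sigma show False
      by simp
  qed
  \<comment> \<open>For b = 0 the relation \<eta> reads a \<alpha> = 0, and v is the image of that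
    vector.\<close>
  then show "v = 0"
    using \<eta> v' by (metis add.right_neutral matrix_vector_mult_0_right vec.scale_zero_left)
qed

text \<open>The parameter is r = 1/\<open>mu_u \<rho> \<theta> 1\<close>. The last identity holds
  since Re(r^2) = cos(\<theta>)/\<rho> = -1/\<rho>^2 and |r|^4 = 1/\<rho>^2.\<close>

lemma eigenvector_parameter:
  fixes muh \<rho> \<theta> :: real
  assumes muh: "muh > 0" and \<rho>: "\<rho> = sqrt (1 + muh)"
    and tan: "tan \<theta> = - sqrt muh" and \<theta>: "\<theta> \<in> {pi / 2 <..< pi}"
  obtains r where "Vu \<rho> \<theta> = (\<lambda>j. if j = 1 then eigvec r else vec_cnj (eigvec r))"
    "Vs \<rho> \<theta> = (\<lambda>j. if j = 1 then eigvec (- r) else vec_cnj (eigvec (- r)))"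
    "r \<noteq> cnj r" "r\<^sup>2 + (cnj r)\<^sup>2 + 2 * r\<^sup>2 * (cnj r)\<^sup>2 = 0"
proof
  define r where "r = complex_of_real (1 / sqrt \<rho>) * exp (- \<i> * complex_of_real (\<theta> / 2))"
  have pos: "\<rho> > 0" using muh \<rho> by simp
  have r2: "r\<^sup>2 = complex_of_real (1 / \<rho>) * exp (- \<i> * complex_of_real \<theta>)"
  proof -
    have "r\<^sup>2 = complex_of_real ((1 / sqrt \<rho>)\<^sup>2) * exp (2 * (- \<i> * complex_of_real (\<theta> / 2)))"
      by (simp only: r_def power_mult_distrib of_real_power exp_double)
    then show ?thesis using pos by (simp add: power_divide)
  qed
  have inv: "1 / r = complex_of_real (sqrt \<rho>) * exp (\<i> * complex_of_real (\<theta> / 2))"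
    using pos by (simp add: r_def exp_minus field_simps)
  have c: "c_const \<rho> \<theta> = 1 / r + 2 * r"
    unfolding c_const_def inv by (simp add: r_def)
  have u: "V1u \<rho> \<theta> = eigvec r"
    unfolding V1u_def eigvec_def r2 c[symmetric] by (simp only: r_def)
  have s: "V1s \<rho> \<theta> = eigvec (- r)"
    unfolding V1s_def eigvec_def power2_minus r2 c by (simp add: r_def)
  show "Vu \<rho> \<theta> = (\<lambda>j. if j = 1 then eigvec r else vec_cnj (eigvec r))"
    "Vs \<rho> \<theta> = (\<lambda>j. if j = 1 then eigvec (- r) else vec_cnj (eigvec (- r)))"
    by (auto simp: fun_eq_iff Vu_def Vs_def u s)
  have "sin (\<theta> / 2) > 0"
    using \<theta> by (intro sin_gt_zero) auto
  then have "Im r \<noteq> 0"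
    using pos by (simp add: r_def Im_exp)
  then show "r \<noteq> cnj r"
    by (simp add: complex_eq_iff)
  \<comment> \<open>The tangent fixes only the square of \<rho> cos(\<theta>); the quadrant selects
    the root -1.\<close>
  have neg: "cos \<theta> < 0"
    using cos_monotone_0_pi[of "pi / 2" \<theta>] \<theta> by (simp add: cos_pi_half)
  then have "1 + muh = inverse ((cos \<theta>)\<^sup>2)"
    using tan_sec[of \<theta>] muh tan by (simp add: power_inverse)
  then have "\<rho>\<^sup>2 * (cos \<theta>)\<^sup>2 = 1"
    using neg muh \<rho> by (simp add: field_simps)
  then have "(\<rho> * cos \<theta>)\<^sup>2 = 1"
    by (simp add: power_mult_distrib)
  moreover have "\<rho> * cos \<theta> < 0"
    using pos neg by (rule mult_pos_neg)
  ultimately have "\<rho> * cos \<theta> = - 1"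
    by (auto simp only: power2_eq_1_iff)
  then have cos: "cos \<theta> = - 1 / \<rho>"
    using pos by (simp add: field_simps)
  have "Re (r\<^sup>2) = - 1 / \<rho>\<^sup>2"
    unfolding r2 by (simp add: Re_exp cos power2_eq_square)
  then have "r\<^sup>2 + (cnj r)\<^sup>2 = complex_of_real (- 2 / \<rho>\<^sup>2)"
    using complex_add_cnj[of "r\<^sup>2"] by simp
  moreover have "(cmod r)\<^sup>2 = 1 / \<rho>"
    using pos by (simp add: r_def norm_mult norm_divide power_divide)
  then have "r * cnj r = complex_of_real (1 / \<rho>)"
    by (metis complex_norm_square)
  then have "r\<^sup>2 * (cnj r)\<^sup>2 = complex_of_real (1 / \<rho>\<^sup>2)"
    by (simp add: power_mult_distrib[symmetric] power_divide)
  ultimately show "r\<^sup>2 + (cnj r)\<^sup>2 + 2 * r\<^sup>2 * (cnj r)\<^sup>2 = 0"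
    by (simp add: mult.assoc)
qed

lemma Re_mu_s_neg:
  assumes "\<rho> > 0" "\<theta> \<in> {pi / 2 <..< pi}"
  shows "Re (mu_s \<rho> \<theta> j) < 0"
proof -
  have "cos (\<theta> / 2) > 0"
    using assms(2) by (intro cos_gt_zero) auto
  then show ?thesis
    using assms(1) by (simp add: mu_s_def mu_u_def Re_exp)
qed

theorem proposition3p10:
  fixes muh nuh \<rho> \<theta> L :: real
    and \<phi> :: "real \<Rightarrow> real"
    and Ws Wu :: "2 \<Rightarrow> real \<Rightarrow> complex^4"
    and U1 :: "real \<Rightarrow> complex^4"
    and \<beta> \<gamma> :: "real \<Rightarrow> complex^2"
    and S U :: "complex^2^4"
    and WS WU :: "real \<Rightarrow> complex^2^4"
  assumes "muh > 0" and "nuh > 0"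
    and "is_pulse muh nuh \<phi>"
    and "\<rho> = sqrt (1 + muh)"
    and "tan \<theta> = - sqrt muh" and "\<theta> \<in> {pi / 2 <..< pi}"
    \<comment> \<open>the solutions \<open>V\<^sub>j\<close> given by their asymptotics at \<open>+\<infinity>\<close>\<close>
    and "\<And>j. lin_solution (BmatC muh nuh \<phi>)
               (\<lambda>x. exp (mu_s \<rho> \<theta> j * complex_of_real x) *s (Vs \<rho> \<theta> j + Ws j x))"
    and "\<And>j. lin_solution (BmatC muh nuh \<phi>)
               (\<lambda>x. exp (mu_u \<rho> \<theta> j * complex_of_real x) *s (Vu \<rho> \<theta> j + Wu j x))"
    and "\<And>j. (Ws j \<longlongrightarrow> 0) at_top"
    and "\<And>j. (Wu j \<longlongrightarrow> 0) at_top"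
    and "S = col_mat (Vs \<rho> \<theta>)" and "U = col_mat (Vu \<rho> \<theta>)"
    and "\<And>x. WS x = col_mat (\<lambda>j. Ws j x)" and "\<And>x. WU x = col_mat (\<lambda>j. Wu j x)"
    \<comment> \<open>\<open>\<lambda> = 0\<close> is a simple eigenvalue\<close>
    and "\<And>x. Eu_minus (BmatC muh nuh \<phi>) x \<inter> Es_plus (BmatC muh nuh \<phi>) x
               = vec.span {vec_of_real (U_phi' \<phi> x)}"
    and "lin_solution (BmatC muh nuh \<phi>) U1"
    and "\<And>x. Eu_minus (BmatC muh nuh \<phi>) x = vec.span {vec_of_real (U_phi' \<phi> x), U1 x}"
    and "\<And>x. U1 x = (S + WS x) *v \<beta> x + (U + WU x) *v \<gamma> x"
    and "\<And>x. \<gamma> x \<noteq> 0"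
    and "\<And>x. x \<ge> L \<Longrightarrow>
               mat_norm (matrix_inv (two_rows 1 4 S) ** two_rows 1 4 (WS x)) < 1"
    and "\<And>x. x \<ge> L \<Longrightarrow>
               sigma_min (M1 S U) (M2 S U) >
                 (mat_norm (M1 S U) + mat_norm (M3 S U (WS x) (WU x)))
                   * (norm (\<beta> x) * inverse (norm (\<gamma> x)) + mat_norm (M4 S U (WS x) (WU x)))
                 + mat_norm (M2 S U) * mat_norm (M3 S U (WS x) (WU x))"
  shows "\<forall>x\<ge>L. \<not> conjugate_point muh nuh \<phi> x
               \<and> Eu_minus (Bmat muh nuh \<phi>) x \<inter> ell_sand = {0}"
proof -
  note muh = assms(1) and \<rho> = assms(4) and tan = assms(5) and \<theta> = assms(6)
    and sol_s = assms(7) and lim_s = assms(9) and S = assms(11) and U = assms(12)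
    and WS = assms(13) and simple = assms(15) and Eu = assms(17) and U1 = assms(18)
    and \<gamma> = assms(19) and K = assms(20) and sigma = assms(21)
  let ?E = "Eu_minus (BmatC muh nuh \<phi>)"
  obtain r where Vu: "Vu \<rho> \<theta> = (\<lambda>j. if j = 1 then eigvec r else vec_cnj (eigvec r))"
    and Vs: "Vs \<rho> \<theta> = (\<lambda>j. if j = 1 then eigvec (- r) else vec_cnj (eigvec (- r)))"
    and r: "r \<noteq> cnj r" "r\<^sup>2 + (cnj r)\<^sup>2 + 2 * r\<^sup>2 * (cnj r)\<^sup>2 = 0"
    using eigenvector_parameter[OF muh \<rho> tan \<theta>] by blast
  have eig: "S = eigmat (- r)" "U = eigmat r"
    unfolding S U Vs Vu eigmat_def by (rule refl)+
  have SU: "two_rows 1 2 S = two_rows 1 2 U" "two_rows 3 4 S = - two_rows 3 4 U"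
    unfolding eig by (rule eigmat_uminus)+
  have inv: "invertible (two_rows 1 4 S)" "invertible (two_rows 1 4 U)"
    unfolding eig using r(1) by (auto intro!: invertible_eigmat)
  obtain s n where herm: "ctranspose (M2 S U) ** M1 S U = herm2 s n" "cmod n \<le> \<bar>s\<bar>"
    unfolding eig using M2_ctranspose_M1_eigmat[OF r] by blast
  have "\<rho> > 0" using muh \<rho> by simp
  have Es: "(S + WS x) *v \<xi> \<in> Es_plus (BmatC muh nuh \<phi>) x" for x \<xi>
  proof -
    have "(S + WS x) *v \<xi> = \<xi> $ 1 *s (Vs \<rho> \<theta> 1 + Ws 1 x) + \<xi> $ 2 *s (Vs \<rho> \<theta> 2 + Ws 2 x)"
      by (simp add: vec_eq_iff matrix_vector_mult_def sum_2 S WS col_mat_def algebra_simps)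
    moreover have "Vs \<rho> \<theta> j + Ws j x \<in> Es_plus (BmatC muh nuh \<phi>) x" for j
      by (rule Es_plus_exp_solution[OF Re_mu_s_neg[OF \<open>\<rho> > 0\<close> \<theta>] sol_s lim_s])
    ultimately show ?thesis
      by (simp only: Es_plus_add Es_plus_smult)
  qed
  have sand: "v = 0" if x: "x \<ge> L" and v: "v \<in> Eu_minus (Bmat muh nuh \<phi>) x" "v \<in> ell_sand" for x v
  proof -
    let ?p = "vec_of_real (U_phi' \<phi> x)"
    have p: "?p \<in> ?E x" "?p \<in> Es_plus (BmatC muh nuh \<phi>) x"
      using simple[of x] vec.span_base[of ?p "{?p}"] by auto
    have U1_mem: "U1 x \<in> ?E x"
      unfolding Eu by (rule vec.span_base) simp
    obtain J where "J ** two_rows 1 4 (S + WS x) = mat 1"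
      using remainder_factor[OF inv K[OF x]] by blast
    then have "invertible (two_rows 1 4 (S + WS x))"
      by (auto simp: invertible_left_inverse)
    \<comment> \<open>By simplicity of the eigenvalue, \<open>U_phi'\<close> decays at plus infinity
      too, hence it has no unstable component.\<close>
    then obtain \<alpha> where \<alpha>: "?p = (S + WS x) *v \<alpha>"
      using Es_plus_eq_mult_vec[OF Es _ p(2)] by blast
    have "vec_of_real v \<in> vec.span {?p, U1 x}"
      using Eu_minus_vec_of_real[OF v(1)] unfolding Eu .
    then obtain a where "vec_of_real v - a *s ?p \<in> vec.span {U1 x}"
      by (auto simp: vec.span_insert[of ?p])
    then obtain b where "vec_of_real v - a *s ?p = b *s U1 x"
      by (auto simp: vec.span_singleton)
    then have "vec_of_real v = a *s ((S + WS x) *v \<alpha>)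
        + b *s ((S + WS x) *v \<beta> x + (U + WU x) *v \<gamma> x)"
      unfolding \<alpha> U1 by (simp add: diff_eq_eq add.commute)
    moreover have "vec_of_real v $ 1 = 0" "vec_of_real v $ 4 = 0"
      using v(2) by (auto simp: ell_sand_def vec_of_real_def)
    ultimately have "vec_of_real v = 0"
      using sandwich_zero[OF SU inv K[OF x] herm \<gamma> Es _ _ sigma[OF x]] p(1) U1_mem
      unfolding \<alpha> U1 by blast
    then show "v = 0"
      by (simp add: vec_eq_iff vec_of_real_def)
  qed
  \<comment> \<open>The intersection has to be exactly {0}: an empty one would count as a conjugate
    point by definition.\<close>
  have "0 \<in> Eu_minus (Bmat muh nuh \<phi>) x" for x
    unfolding Eu_minus_def lin_solution_def
    by (intro CollectI exI[of _ "\<lambda>_. 0"]) simp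
  moreover have "0 \<in> ell_sand"
    unfolding ell_sand_def by (intro CollectI exI[of _ 0]) (simp add: vec_eq_iff forall_4)
  ultimately have "Eu_minus (Bmat muh nuh \<phi>) x \<inter> ell_sand = {0}" if "x \<ge> L" for x
    using sand[OF that] by blast
  then show ?thesis
    by (simp add: conjugate_point_def)
qed

end
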